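(* Let $(\mu_{i,j})_{i,j\in\mathbb{N}}$ be real skew-symmetric bi-moments and $(\beta_j)_{j\in\mathbb{N}}$ real numbers such that $\tau_{n}^{(m)}\ne0$ for all $n,m\in\mathbb{N}$, and let $\{Q_n^{(m)}(z)\}_{n\in\mathbb{N}}$ be the $m$-th adjacent family of (one-component) partial-skew-orthogonal polynomials. Then for all $n,m\in\mathbb{N}$ $$Q^{(m)}_{n+1}(z)+\xi^{m}_nQ^{(m)}_n(z)=z\left( Q_n^{(m+1)}(z)+\eta^m_nQ^{(m+1)}_{n-1}(z) \right)$$ with coefficients $$\xi^m_n=\frac{\tau_{n}^{(m)}\tau_{n+1}^{(m+1)}}{\tau_{n+1}^{(m)}\tau_n^{(m+1)}},\qquad \eta_n^m=\frac{\tau_{n+2}^{(m)}\tau_{n-1}^{(m+1)}}{\tau_{n+1}^{(m)}\tau_{n}^{(m+1)}}.$$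
   Context: $\mathbb{N}=\{0,1,2,\ldots\}$. The bi-moments satisfy $\mu_{i,j}=-\mu_{j,i}$. Pfaffian notation: for labels $a_1,\ldots,a_{2N}$, $\mathrm{Pf}(a_1,\ldots,a_{2N})$ is the Pfaffian of the $2N\times 2N$ skew-symmetric matrix whose $(k,l)$ entry is $\mathrm{Pf}(a_k,a_l)=-\mathrm{Pf}(a_l,a_k)$; the empty Pfaffian is $1$. For integer labels $i,j$ and the extra labels $d,z$: $\mathrm{Pf}(i,j)=\mu_{i,j}$, $\mathrm{Pf}(d,i)=\beta_i$, $\mathrm{Pf}(i,z)=z^i$, $\mathrm{Pf}(d,z)=0$. Put $\tau_{2n}^{(m)}=\mathrm{Pf}(m,\ldots,m+2n-1)$ (so $\tau_0^{(m)}=1$) and $\tau_{2n+1}^{(m)}=\mathrm{Pf}(d,m,\ldots,m+2n)$. The $m$-th adjacent family of partial-skew-orthogonal polynomials consists of the monic polynomials (of degree given by the subscript) $$Q_{2n}^{(m)}(z)=\frac{1}{z^m\tau_{2n}^{(m)}}\mathrm{Pf}(m,\ldots,m+2n,z),\qquad Q_{2n+1}^{(m)}(z)=\frac{1}{z^m\tau_{2n+1}^{(m)}}\mathrm{Pf}(d,m,\ldots,m+2n+1,z).$$ Conventions: $\tau_{-1}^{(m)}=0$ and $Q_{-1}^{(m)}=0$. *)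

theory Defs
  imports
    Jordan_Normal_Form.Matrix
    "HOL-Combinatorics.Permutations"
    "HOL-Computational_Algebra.Polynomial"
begin

text \<open>
  The Pfaffian of a skew-symmetric matrix, as the signed sum over perfect matchings
  \<open>{p 0, p 1}, {p 2, p 3}, \<dots>\<close> of the row indices. Each matching is represented by the unique
  permutation \<open>p\<close> with \<open>p (2i) < p (2i+1)\<close> and \<open>p 0 < p 2 < p 4 < \<dots>\<close>. This form needs no
  division and so makes sense over the polynomial ring.
\<close>

definition matching_perms :: "nat \<Rightarrow> (nat \<Rightarrow> nat) set" where
  "matching_perms N = {p. p permutes {..<2 * N} \<and>
     (\<forall>i<N. p (2 * i) < p (2 * i + 1)) \<and>
     (\<forall>i<N. \<forall>j<N. i < j \<longrightarrow> p (2 * i) < p (2 * j))}"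

definition pfaffian :: "'a::comm_ring_1 mat \<Rightarrow> 'a" where
  "pfaffian A = (if odd (dim_row A) then 0 else
     (let N = dim_row A div 2 in
       \<Sum>p\<in>matching_perms N. of_int (sign p) * (\<Prod>i<N. A $$ (p (2 * i), p (2 * i + 1)))))"

text \<open>
  The label \<open>z\<close> carries the ring element it stands for, so that Pfaffians without it can be
  taken over the reals, and those with it over the polynomials with \<open>z\<close> the indeterminate.
\<close>

datatype 'a label = Idx nat | D | Z 'a

fun pf_entry :: "(nat \<Rightarrow> nat \<Rightarrow> 'a::comm_ring_1) \<Rightarrow> (nat \<Rightarrow> 'a) \<Rightarrow> 'a label \<Rightarrow> 'a label \<Rightarrow> 'a" where
  "pf_entry \<mu> \<beta> (Idx i) (Idx j) = \<mu> i j"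
| "pf_entry \<mu> \<beta> D (Idx i) = \<beta> i"
| "pf_entry \<mu> \<beta> (Idx i) D = - \<beta> i"
| "pf_entry \<mu> \<beta> (Idx i) (Z z) = z ^ i"
| "pf_entry \<mu> \<beta> (Z z) (Idx i) = - (z ^ i)"
| "pf_entry \<mu> \<beta> D (Z z) = 0"
| "pf_entry \<mu> \<beta> (Z z) D = 0"
| "pf_entry \<mu> \<beta> D D = 0"
| "pf_entry \<mu> \<beta> (Z z) (Z w) = 0"

definition Pf :: "(nat \<Rightarrow> nat \<Rightarrow> 'a::comm_ring_1) \<Rightarrow> (nat \<Rightarrow> 'a) \<Rightarrow> 'a label list \<Rightarrow> 'a" where
  "Pf \<mu> \<beta> as =
     pfaffian (mat (length as) (length as) (\<lambda>(k, l). pf_entry \<mu> \<beta> (as ! k) (as ! l)))"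

text \<open>
  The subscript is an integer so that the conventions at \<open>-1\<close> can be stated; smaller subscripts
  do not occur.
\<close>

definition tau :: "(nat \<Rightarrow> nat \<Rightarrow> real) \<Rightarrow> (nat \<Rightarrow> real) \<Rightarrow> nat \<Rightarrow> int \<Rightarrow> real" where
  "tau \<mu> \<beta> m k =
     (if k < 0 then 0
      else if even k then Pf \<mu> \<beta> (map Idx [m..<m + nat k])
      else Pf \<mu> \<beta> (D # map Idx [m..<m + nat k]))"

definition Pf_poly :: "(nat \<Rightarrow> nat \<Rightarrow> real) \<Rightarrow> (nat \<Rightarrow> real) \<Rightarrow> real poly label list \<Rightarrow> real poly" where
  "Pf_poly \<mu> \<beta> = Pf (\<lambda>i j. [:\<mu> i j:]) (\<lambda>i. [:\<beta> i:])"

text \<open>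
  The division by \<open>z ^ m\<close> is the division of polynomials, which is exact here by
  \<open>monom_dvd_Pf_poly\<close> below.
\<close>

definition Q :: "(nat \<Rightarrow> nat \<Rightarrow> real) \<Rightarrow> (nat \<Rightarrow> real) \<Rightarrow> nat \<Rightarrow> int \<Rightarrow> real poly" where
  "Q \<mu> \<beta> m k =
     (if k < 0 then 0
      else if even k then
        smult (1 / tau \<mu> \<beta> m k)
          (Pf_poly \<mu> \<beta> (map Idx [m..<m + nat k + 1] @ [Z [:0, 1:]]) div [:0, 1:] ^ m)
      else
        smult (1 / tau \<mu> \<beta> m k)
          (Pf_poly \<mu> \<beta> (D # map Idx [m..<m + nat k + 1] @ [Z [:0, 1:]]) div [:0, 1:] ^ m))"

lemma monom_dvd_Pf_poly:
  assumes "\<And>i. Idx i \<in> set as \<Longrightarrow> m \<le> i"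
  shows "[:0, 1:] ^ m dvd Pf_poly \<mu> \<beta> (as @ [Z [:0, 1:]])"
proof (cases "odd (length (as @ [Z [:0, 1:]]))")
  case True
  then show ?thesis by (simp add: Pf_poly_def Pf_def pfaffian_def)
next
  case False
  let ?bs = "as @ [Z [:0, 1:]]"
  let ?e = "pf_entry (\<lambda>i j. [:\<mu> i j:]) (\<lambda>i. [:\<beta> i:])"
  define A where "A = mat (length ?bs) (length ?bs) (\<lambda>(k, l). ?e (?bs ! k) (?bs ! l))"
  obtain N where N: "length ?bs = 2 * N" using False by (meson evenE)
  have "[:0, 1:] ^ m dvd (\<Prod>i<N. A $$ (p (2 * i), p (2 * i + 1)))"
    if "p \<in> matching_perms N" for p
  proof -
    have p: "p permutes {..<2 * N}" using that by (simp add: matching_perms_def)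
    obtain k where pk: "p k = length as" using permutes_surj[OF p] by (metis surjD)
    have k: "k < 2 * N" using permutes_in_image[OF p, of k] pk N by simp
    define i where "i = k div 2"
    have i: "i < N" using k by (simp add: i_def)
    have lt: "p (2 * i) < length ?bs" "p (2 * i + 1) < length ?bs"
      using permutes_in_image[OF p, of "2 * i"] permutes_in_image[OF p, of "2 * i + 1"] i N
      by auto
    have cases: "?bs ! p (2 * i) = Z [:0, 1:] \<or> ?bs ! p (2 * i + 1) = Z [:0, 1:]"
    proof (cases "even k")
      case True
      then have "2 * i = k" by (simp add: i_def)
      then show ?thesis using pk by simp
    next
      case False
      then have "2 * i + 1 = k" by (simp add: i_def)
      then show ?thesis using pk by simp
    qed
    have key: "[:0, 1:] ^ m dvd ?e x y"
      if "x = Z [:0, 1:] \<or> y = Z [:0, 1:]" "x \<in> set ?bs" "y \<in> set ?bs" for x y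
      using that assms by (cases x; cases y) (auto intro: le_imp_power_dvd)
    have "[:0, 1:] ^ m dvd A $$ (p (2 * i), p (2 * i + 1))"
      unfolding A_def using key[OF cases] lt nth_mem[OF lt(1)] nth_mem[OF lt(2)] by simp
    also have "\<dots> dvd (\<Prod>i<N. A $$ (p (2 * i), p (2 * i + 1)))"
      using i by (intro dvd_prodI) auto
    finally show ?thesis .
  qed
  then have "[:0, 1:] ^ m dvd pfaffian A"
    using N by (auto simp: pfaffian_def A_def Let_def intro!: dvd_sum dvd_mult)
  then show ?thesis by (simp add: Pf_poly_def Pf_def A_def)
qed

end

theory Submission
  imports Defs Jordan_Normal_Form.Determinant
begin

text \<open>
  Expanding along the first entry, \<open>\<Sum>i. (-1)^i Pf(A - a\<^sub>i) Pf(a\<^sub>i, C)\<close> and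
  \<open>- \<Sum>j. (-1)^j Pf(c\<^sub>j, A) Pf(C - c\<^sub>j)\<close> become the same double sum over \<open>i, j\<close>, so they agree for
  all lists of labels \<open>A\<close> and \<open>C\<close>. If \<open>A\<close> and \<open>C\<close> share most of their labels, nearly all terms vanish.
  With \<open>B = (m+1, \<dots>, m+n)\<close> and \<open>M = m+n+1\<close>, the choice \<open>A = (d, B)\<close>, \<open>C = (m, B, M, z)\<close> for even \<open>n\<close>,
  and \<open>A = B\<close>, \<open>C = (d, m, B, M, z)\<close> for odd \<open>n\<close>, leaves exactly the four products obtained by
  clearing denominators in the claim.
\<close>

section \<open>Perfect matchings, sorted by the partner of the first point\<close>

text \<open>
  The matching on \<open>2N + 2\<close> points that pairs \<open>0\<close> with \<open>k + 1\<close> and carries \<open>q\<close> on the remaining points.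
\<close>

definition matching_insert :: "nat \<Rightarrow> (nat \<Rightarrow> nat) \<Rightarrow> nat \<Rightarrow> nat" where
  "matching_insert k q = permutation_insert 0 0 (permutation_insert 0 k q)"

lemma matching_insert_simps [simp]:
  "matching_insert k q 0 = 0"
  "matching_insert k q (Suc 0) = Suc k"
  "matching_insert k q (Suc (Suc j)) = Suc (insert_index k (q j))"
  by (simp_all add: matching_insert_def permutation_insert_expand insert_index_def)

lemma matching_insert_permutes:
  assumes "q permutes {..<n}" "k < Suc n"
  shows "matching_insert k q permutes {..<Suc (Suc n)}"
  using assms unfolding matching_insert_def lessThan_atLeast0
  by (intro permutation_insert_permutes) auto

text \<open>The outer insertion at \<open>(0, 0)\<close> keeps the sign, the inner one at
  \<open>(0, k)\<close> contributes \<open>(-1) ^ k\<close>. This becomes the sign in the expansion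
  of the Pfaffian.\<close>

lemma sign_matching_insert:
  assumes "q permutes {..<n}" "k < Suc n"
  shows "sign (matching_insert k q) = (-1) ^ k * sign q"
  using assms permutation_insert_permutes[of q n 0 k]
  unfolding matching_insert_def lessThan_atLeast0
  using signof_permutation_insert[of _ _ 0 _, where 'a = int]
  by simp

lemma insert_index_less_iff: "insert_index k x < insert_index k y \<longleftrightarrow> x < y"
  by (auto simp: insert_index_def)

text \<open>The new pair \<open>(0, k + 1)\<close> meets the order conditions by itself, and
  \<open>insert_index k\<close> is strictly monotone, so the conditions on the other pairs are
  exactly those on \<open>q\<close>.\<close>

lemma matching_insert_in_matching_perms_iff:
  assumes "q permutes {..<2 * N}" "k < Suc (2 * N)"
  shows "matching_insert k q \<in> matching_perms (Suc N) \<longleftrightarrow> q \<in> matching_perms N"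
  using assms matching_insert_permutes[OF assms]
  by (simp add: matching_perms_def All_less_Suc2 insert_index_less_iff)

text \<open>The value \<open>0\<close> cannot be the larger member of a pair, nor the first member
  of a later pair, since first members increase.\<close>

lemma matching_perms_0:
  assumes "p \<in> matching_perms (Suc N)"
  shows "p 0 = 0"
proof (rule ccontr)
  assume "p 0 \<noteq> 0"
  have p: "p permutes {..<2 * Suc N}"
    and lt: "\<And>i. i < Suc N \<Longrightarrow> p (2 * i) < p (2 * i + 1)"
    and mono: "\<And>i. 0 < i \<Longrightarrow> i < Suc N \<Longrightarrow> p 0 < p (2 * i)"
    using assms by (force simp: matching_perms_def)+
  obtain j where j: "p j = 0" using permutes_surj[OF p] by (metis surjD)
  have "j < 2 * Suc N" using permutes_in_image[OF p, of j] j by simp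
  then have i: "j div 2 < Suc N" by auto
  have "j = 2 * (j div 2) \<or> j = 2 * (j div 2) + 1" by presburger
  then show False
    using lt[OF i] mono[OF _ i] j \<open>p 0 \<noteq> 0\<close>
    by (metis gr_zeroI mult_0_right not_less_zero)
qed

text \<open>Injective, as the value at \<open>1\<close> reveals \<open>k\<close> and
  \<open>insert_index k\<close> is injective. Surjective, as deleting position \<open>0\<close>
  twice undoes the insertion when \<open>p 0 = 0\<close>.\<close>

lemma matching_perms_Suc:
  "bij_betw (\<lambda>(k, q). matching_insert k q)
     ({..<Suc (2 * N)} \<times> matching_perms N) (matching_perms (Suc N))"
proof (rule bij_betwI')
  fix x y assume "x \<in> {..<Suc (2 * N)} \<times> matching_perms N" "y \<in> {..<Suc (2 * N)} \<times> matching_perms N"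
  show "((case x of (k, q) \<Rightarrow> matching_insert k q) = (case y of (k, q) \<Rightarrow> matching_insert k q)) = (x = y)"
  proof (cases x; cases y, safe)
    fix k q l r assume eq: "matching_insert k q = matching_insert l r"
    show kl: "k = l" using fun_cong[OF eq, of "Suc 0"] by simp
    have "insert_index k (q j) = insert_index k (r j)" for j
      using fun_cong[OF eq, of "Suc (Suc j)"] kl by simp
    then show "q = r" by (metis delete_insert_index ext)
  qed
next
  fix x assume "x \<in> {..<Suc (2 * N)} \<times> matching_perms N"
  then show "(case x of (k, q) \<Rightarrow> matching_insert k q) \<in> matching_perms (Suc N)"
    using matching_insert_in_matching_perms_iff[of "snd x" N "fst x"]
    by (simp add: case_prod_unfold mem_Times_iff matching_perms_def)
next
  fix p assume p: "p \<in> matching_perms (Suc N)"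
  then have perm: "p permutes {0..<Suc (Suc (2 * N))}"
    by (simp add: matching_perms_def lessThan_atLeast0)
  define p' where "p' = permutation_delete p 0"
  have p': "p' permutes {0..<Suc (2 * N)}"
    unfolding p'_def by (rule permutation_delete_permutes[OF perm]) simp
  define q where "q = permutation_delete p' 0"
  have q: "q permutes {..<2 * N}"
    unfolding q_def lessThan_atLeast0 by (rule permutation_delete_permutes[OF p']) simp
  have eq: "matching_insert (p' 0) q = p"
    using permutation_insert_delete[OF perm, of 0] permutation_insert_delete[OF p', of 0]
      matching_perms_0[OF p] by (simp add: matching_insert_def q_def p'_def)
  have k: "p' 0 < Suc (2 * N)" using permutes_in_image[OF p', of 0] by simp
  have "q \<in> matching_perms N"
    using matching_insert_in_matching_perms_iff[OF q k] eq p by simp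
  then show "\<exists>x\<in>{..<Suc (2 * N)} \<times> matching_perms N. p = (case x of (k, q) \<Rightarrow> matching_insert k q)"
    using k eq by force
qed

section \<open>Expansion of a Pfaffian along its first label\<close>

definition remove_nth :: "nat \<Rightarrow> 'a list \<Rightarrow> 'a list" where
  "remove_nth k xs = take k xs @ drop (Suc k) xs"

lemma length_remove_nth: "k < length xs \<Longrightarrow> length (remove_nth k xs) = length xs - 1"
  by (simp add: remove_nth_def)

lemma nth_remove_nth:
  "k < length xs \<Longrightarrow> remove_nth k xs ! j = xs ! insert_index k j"
  by (auto simp: remove_nth_def nth_append insert_index_def)

lemma Pf_even:
  assumes "length as = 2 * N"
  shows "Pf \<mu> \<beta> as = (\<Sum>p\<in>matching_perms N. of_int (sign p) *
    (\<Prod>i<N. pf_entry \<mu> \<beta> (as ! p (2 * i)) (as ! p (2 * i + 1))))"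
proof -
  have "p (2 * i) < 2 * N \<and> p (2 * i + 1) < 2 * N" if "p \<in> matching_perms N" "i < N" for p i
    using that permutes_in_image[of p "{..<2 * N}"] by (simp add: matching_perms_def)
  then show ?thesis
    unfolding Pf_def pfaffian_def using assms
    by (auto simp: Let_def intro!: sum.cong prod.cong)
qed

lemma Pf_odd: "odd (length as) \<Longrightarrow> Pf \<mu> \<beta> as = 0"
  by (simp add: Pf_def pfaffian_def)

lemma Pf_Nil: "Pf \<mu> \<beta> [] = 1"
proof -
  have "matching_perms 0 = {id}" by (auto simp: matching_perms_def)
  then show ?thesis by (simp add: Pf_even[of _ 0])
qed

text \<open>Matchings are grouped by the partner of \<open>a\<close>. For even
  \<open>length bs\<close> both sides vanish, so the expansion holds for every list and can be
  iterated freely.\<close>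

lemma Pf_Cons:
  "Pf \<mu> \<beta> (a # bs) = (\<Sum>k<length bs. (-1) ^ k * pf_entry \<mu> \<beta> a (bs ! k) * Pf \<mu> \<beta> (remove_nth k bs))"
proof (cases "even (length bs)")
  case True
  have "Pf \<mu> \<beta> (remove_nth k bs) = 0" if "k < length bs" for k
    using that True by (intro Pf_odd) (auto simp: length_remove_nth)
  then show ?thesis using True by (simp add: Pf_odd)
next
  case False
  then obtain N where N: "length bs = Suc (2 * N)" by (metis oddE Suc_eq_plus1)
  let ?e = "pf_entry \<mu> \<beta>"
  let ?g = "\<lambda>as p n. of_int (sign p) * (\<Prod>i<n. ?e (as ! p (2 * i)) (as ! p (2 * i + 1)))"
  have "Pf \<mu> \<beta> (a # bs) = (\<Sum>p\<in>matching_perms (Suc N). ?g (a # bs) p (Suc N))"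
    using N by (intro Pf_even) simp
  also have "\<dots> = (\<Sum>(k, q)\<in>{..<Suc (2 * N)} \<times> matching_perms N.
      ?g (a # bs) (matching_insert k q) (Suc N))"
    by (subst sum.reindex_bij_betw[OF matching_perms_Suc, symmetric]) (simp add: case_prod_unfold)
  also have "\<dots> = (\<Sum>(k, q)\<in>{..<Suc (2 * N)} \<times> matching_perms N.
      (-1) ^ k * ?e a (bs ! k) * ?g (remove_nth k bs) q N)"
  proof (intro sum.cong refl, clarify)
    fix k q assume k: "k < Suc (2 * N)" and q: "q \<in> matching_perms N"
    then show "?g (a # bs) (matching_insert k q) (Suc N) =
      (-1) ^ k * ?e a (bs ! k) * ?g (remove_nth k bs) q N"
      using N by (simp add: prod.lessThan_Suc_shift sign_matching_insert[of q "2 * N"] matching_perms_def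
          nth_remove_nth mult_ac del: prod.lessThan_Suc)
  qed
  also have "\<dots> = (\<Sum>k<Suc (2 * N). (-1) ^ k * ?e a (bs ! k) * Pf \<mu> \<beta> (remove_nth k bs))"
    using N by (simp add: sum.cartesian_product[symmetric] sum_distrib_left Pf_even[of _ N] length_remove_nth
        del: sum.lessThan_Suc)
  finally show ?thesis using N by simp
qed

section \<open>Repeated removal from lists and sums over pairs of positions\<close>

lemma remove_nth_Cons_0 [simp]: "remove_nth 0 (x # xs) = xs"
  by (simp add: remove_nth_def)

lemma remove_nth_Cons_Suc [simp]: "remove_nth (Suc k) (x # xs) = x # remove_nth k xs"
  by (simp add: remove_nth_def)

lemma remove_nth_append1: "k < length xs \<Longrightarrow> remove_nth k (xs @ ys) = remove_nth k xs @ ys"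
  by (simp add: remove_nth_def)

lemma remove_nth_append2: "remove_nth (length xs + k) (xs @ ys) = xs @ remove_nth k ys"
  by (simp add: remove_nth_def)

lemma remove_nth_remove_nth:
  "l < k \<Longrightarrow> k < length xs \<Longrightarrow> remove_nth l (remove_nth k xs) = remove_nth (k - 1) (remove_nth l xs)"
  by (intro nth_equalityI) (auto simp: length_remove_nth nth_remove_nth insert_index_def)

lemma sum_lessThan_add:
  fixes f :: "nat \<Rightarrow> 'a::comm_monoid_add"
  shows "(\<Sum>k<m + n. f k) = (\<Sum>k<m. f k) + (\<Sum>k<n. f (m + k))"
  by (induction n) (simp_all add: add.assoc)

text \<open>Read \<open>(k, l)\<close> as removing position \<open>k\<close> and then position
  \<open>l\<close> of the shortened list. The right side collects the two orders of removing the
  same positions \<open>l < k\<close>.\<close>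

lemma sum_lessThan_off_diagonal:
  fixes F :: "nat \<Rightarrow> nat \<Rightarrow> 'a::comm_monoid_add"
  shows "(\<Sum>k<n. \<Sum>l<n - 1. F k l) = (\<Sum>k<n. \<Sum>l<k. F k l + F l (k - 1))"
proof (induction n)
  case (Suc n)
  have "(\<Sum>k<Suc n. \<Sum>l<n. F k l) = (\<Sum>k<n. \<Sum>l<n. F k l) + (\<Sum>l<n. F n l)"
    by (rule sum.lessThan_Suc)
  \<comment> \<open>The split-off column \<open>l = n - 1\<close> joins the new row \<open>n\<close>
    to form the summand \<open>k = n\<close> of the right side.\<close>
  also have "(\<Sum>k<n. \<Sum>l<n. F k l) = (\<Sum>k<n. (\<Sum>l<n - 1. F k l) + F k (n - 1))"
    by (cases n) simp_all
  also have "\<dots> + (\<Sum>l<n. F n l) =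
      (\<Sum>k<n. \<Sum>l<n - 1. F k l) + (\<Sum>l<n. F n l + F l (n - 1))"
    by (simp add: sum.distrib add_ac)
  also have "\<dots> = (\<Sum>k<Suc n. \<Sum>l<k. F k l + F l (k - 1))"
    unfolding Suc.IH by simp
  finally show ?case by simp
qed simp

section \<open>Antisymmetry of the Pfaffian in its labels\<close>

lemma pf_entry_skew:
  assumes "\<And>i j. \<mu> i j = - \<mu> j i"
  shows "pf_entry \<mu> \<beta> a b = - pf_entry \<mu> \<beta> b a"
  by (cases a; cases b) (auto intro: assms)

lemma Pf_Cons_append:
  "Pf \<mu> \<beta> (a # us @ ws) =
    (\<Sum>k<length us. (-1) ^ k * pf_entry \<mu> \<beta> a (us ! k) * Pf \<mu> \<beta> (remove_nth k us @ ws)) +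
    (-1) ^ length us *
      (\<Sum>k<length ws. (-1) ^ k * pf_entry \<mu> \<beta> a (ws ! k) * Pf \<mu> \<beta> (us @ remove_nth k ws))"
  unfolding Pf_Cons[of _ _ a] length_append sum_lessThan_add
  by (simp add: nth_append remove_nth_append1 remove_nth_append2 power_add sum_distrib_left mult_ac)

text \<open>Expanding along both labels leaves the pairing of \<open>x\<close> with
  \<open>y\<close>, which is skew, and a sum over two distinct partners in \<open>vs\<close>, where
  exchanging \<open>x\<close> and \<open>y\<close> reverses the order of removal.\<close>

lemma Pf_swap_Cons:
  assumes skew: "\<And>i j. \<mu> i j = - \<mu> j i"
  shows "Pf \<mu> \<beta> (x # y # vs) = - Pf \<mu> \<beta> (y # x # vs)"
proof -
  let ?e = "pf_entry \<mu> \<beta>"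
  let ?F = "\<lambda>x y k l. (-1) ^ (k + l) * (?e x (vs ! k) * ?e y (remove_nth k vs ! l) *
    Pf \<mu> \<beta> (remove_nth l (remove_nth k vs)))"
  let ?S = "\<lambda>x y. \<Sum>k<length vs. \<Sum>l<length vs - 1. ?F x y k l"
  have expand: "Pf \<mu> \<beta> (x # y # vs) = ?e x y * Pf \<mu> \<beta> vs - ?S x y" for x y
    by (simp add: Pf_Cons[of _ _ x] Pf_Cons[of _ _ y] sum.lessThan_Suc_shift length_remove_nth
        sum_distrib_left sum_negf power_add mult_ac del: sum.lessThan_Suc)
  \<comment> \<open>Removing the earlier position \<open>l\<close> first lowers the index
    \<open>k\<close> by one, so the two orders of removal carry opposite signs.\<close>
  have "?F x y k l + ?F x y l (k - 1) = - (?F y x k l + ?F y x l (k - 1))"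
    if "l < k" "k < length vs" for k l
  proof -
    from that obtain k' where k': "k = Suc k'" by (cases k) auto
    have "remove_nth l (remove_nth k vs) = remove_nth k' (remove_nth l vs)"
      using that k' by (simp add: remove_nth_remove_nth)
    moreover have "remove_nth k vs ! l = vs ! l" "remove_nth l vs ! k' = vs ! k"
      using that k' by (simp_all add: nth_remove_nth)
    ultimately show ?thesis using k' by (simp add: algebra_simps)
  qed
  then have "?S x y = - ?S y x"
    unfolding sum_lessThan_off_diagonal by (simp add: sum_negf[symmetric])
  then show ?thesis
    using pf_entry_skew[of \<mu> \<beta> x y, OF skew] unfolding expand by simp
qed

text \<open>Expansion along the head of the prefix shortens the prefix. Partners other than
  \<open>x\<close> and \<open>y\<close> fall to the induction hypothesis; the terms with partner
  \<open>x\<close> and with partner \<open>y\<close> trade places, with opposite signs.\<close>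

lemma Pf_swap:
  assumes skew: "\<And>i j. \<mu> i j = - \<mu> j i"
  shows "Pf \<mu> \<beta> (us @ x # y # vs) = - Pf \<mu> \<beta> (us @ y # x # vs)"
proof (induction "length us" arbitrary: us vs rule: less_induct)
  case less
  show ?case
  proof (cases us)
    case Nil
    show ?thesis unfolding Nil append_Nil by (rule Pf_swap_Cons[OF skew])
  next
    case (Cons a us')
    have "Pf \<mu> \<beta> (remove_nth k us' @ x # y # vs) = - Pf \<mu> \<beta> (remove_nth k us' @ y # x # vs)"
      if "k < length us'" for k
      using that Cons by (intro less) (simp add: length_remove_nth)
    moreover have "Pf \<mu> \<beta> (us' @ x # y # ws) = - Pf \<mu> \<beta> (us' @ y # x # ws)" for ws
      using Cons by (intro less) simp
    ultimately show ?thesis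
      unfolding Cons append_Cons Pf_Cons_append
      by (simp add: sum.lessThan_Suc_shift sum_negf algebra_simps del: sum.lessThan_Suc)
  qed
qed

lemma Pf_move:
  assumes skew: "\<And>i j. \<mu> i j = - \<mu> j i"
  shows "Pf \<mu> \<beta> (x # us @ vs) = (-1) ^ length us * Pf \<mu> \<beta> (us @ x # vs)"
proof (induction us arbitrary: vs rule: rev_induct)
  case (snoc u us)
  show ?case
    using snoc.IH[of "u # vs"]
      Pf_swap[where \<mu> = \<mu> and \<beta> = \<beta> and us = us and x = x and y = u and vs = vs, OF skew]
    by simp
qed simp

text \<open>
  The diagonal entries vanish only because \<open>2\<close> is cancellable, whence the restriction on the ring.
\<close>

lemma Pf_eq_0:
  fixes \<mu> :: "nat \<Rightarrow> nat \<Rightarrow> 'a::{idom, ring_char_0}"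
  assumes skew: "\<And>i j. \<mu> i j = - \<mu> j i" and "x \<in> set as"
  shows "Pf \<mu> \<beta> (x # as) = 0"
proof -
  obtain us vs where as: "as = us @ x # vs" using \<open>x \<in> set as\<close> by (metis split_list)
  have "Pf \<mu> \<beta> (us @ x # x # vs) + Pf \<mu> \<beta> (us @ x # x # vs) = 0"
    unfolding eq_neg_iff_add_eq_0[symmetric] by (rule Pf_swap[OF skew])
  then have "Pf \<mu> \<beta> (us @ x # x # vs) = 0" by (simp flip: mult_2)
  then show ?thesis
    using Pf_move[where \<mu> = \<mu> and \<beta> = \<beta> and x = x and us = us and vs = "x # vs", OF skew] as by simp
qed

section \<open>The exchange identity and two Pluecker relations\<close>

lemma Pf_exchange:
  assumes skew: "\<And>i j. \<mu> i j = - \<mu> j i"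
  shows "(\<Sum>i<length as. (-1) ^ i * Pf \<mu> \<beta> (remove_nth i as) * Pf \<mu> \<beta> (as ! i # cs)) =
    - (\<Sum>j<length cs. (-1) ^ j * Pf \<mu> \<beta> (cs ! j # as) * Pf \<mu> \<beta> (remove_nth j cs))"
    (is "?L = - ?R")
proof -
  let ?t = "\<lambda>i j. (-1) ^ (i + j) * Pf \<mu> \<beta> (remove_nth i as) * pf_entry \<mu> \<beta> (as ! i) (cs ! j) *
    Pf \<mu> \<beta> (remove_nth j cs)"
  have "?L = (\<Sum>i<length as. \<Sum>j<length cs. ?t i j)"
    by (simp add: Pf_Cons sum_distrib_left power_add mult_ac)
  also have "\<dots> = (\<Sum>j<length cs. \<Sum>i<length as. ?t i j)"
    by (rule sum.swap)
  also have "\<dots> = - ?R"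
    \<comment> \<open>The minus sign comes from turning the entry of \<open>as ! i\<close> and
      \<open>cs ! j\<close> around.\<close>
    by (simp add: Pf_Cons[of _ _ "cs ! _"] pf_entry_skew[of \<mu> \<beta> "as ! _", OF skew]
        sum_distrib_left sum_distrib_right sum_negf power_add mult_ac)
  finally show ?thesis .
qed

lemma sum_lessThan_middle:
  fixes f :: "nat \<Rightarrow> 'a::comm_monoid_add"
  shows "(\<Sum>k<Suc (Suc (Suc n)). f k) = f 0 + (\<Sum>k<n. f (Suc k)) + f (Suc n) + f (Suc (Suc n))"
  unfolding sum.lessThan_Suc_shift[of _ "Suc (Suc n)"] by (simp add: add.assoc)

text \<open>\<open>Pf_exchange\<close> for \<open>a # B\<close> and \<open>b # B @ [c, d]\<close>:
  the labels of \<open>B\<close> lie in both lists and give zero, so \<open>a\<close> survives on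
  one side and \<open>b\<close>, \<open>c\<close>, \<open>d\<close> on the other. For odd
  \<open>length B\<close> every product is zero.\<close>

lemma Pf_plucker_even:
  fixes \<mu> :: "nat \<Rightarrow> nat \<Rightarrow> 'a::{idom, ring_char_0}"
  assumes skew: "\<And>i j. \<mu> i j = - \<mu> j i"
  shows "Pf \<mu> \<beta> B * Pf \<mu> \<beta> (a # b # B @ [c, d]) + Pf \<mu> \<beta> (a # B @ [c]) * Pf \<mu> \<beta> (b # B @ [d]) =
    Pf \<mu> \<beta> (a # b # B) * Pf \<mu> \<beta> (B @ [c, d]) + Pf \<mu> \<beta> (b # B @ [c]) * Pf \<mu> \<beta> (a # B @ [d])"
    (is "?p + ?r = ?q + ?s")
proof -
  let ?as = "a # B" and ?cs = "b # B @ [c, d]"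
  note zero = Pf_eq_0[where \<mu> = \<mu>, OF skew]
  have move: "Pf \<mu> \<beta> (x # a # B) = (-1) ^ Suc (length B) * Pf \<mu> \<beta> (a # B @ [x])" for x
    using Pf_move[where \<mu> = \<mu> and us = "a # B" and vs = "[]", OF skew] by simp
  have swap: "Pf \<mu> \<beta> (b # a # B) = - Pf \<mu> \<beta> (a # b # B)"
    by (rule Pf_swap_Cons[OF skew])
  have nth: "remove_nth (length B) (B @ [c, d]) = B @ [d]"
    "remove_nth (Suc (length B)) (B @ [c, d]) = B @ [c]"
    using remove_nth_append2[of B 0 "[c, d]"] remove_nth_append2[of B 1 "[c, d]"] by simp_all
  have "(\<Sum>i<length ?as. (-1) ^ i * Pf \<mu> \<beta> (remove_nth i ?as) * Pf \<mu> \<beta> (?as ! i # ?cs)) = ?p"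
    unfolding list.size(4) add_Suc_right add_0_right sum.lessThan_Suc_shift by (simp add: zero)
  \<comment> \<open>Moving \<open>c\<close> or \<open>d\<close> to the end costs
    \<open>(-1) ^ Suc (length B)\<close>, which cancels the alternating sign for \<open>c\<close>
    and leaves a minus for \<open>d\<close>.\<close>
  moreover have "(\<Sum>j<Suc (Suc (Suc (length B))). (-1) ^ j * Pf \<mu> \<beta> (?cs ! j # ?as) * Pf \<mu> \<beta> (remove_nth j ?cs)) =
    ?r - ?q - ?s"
    unfolding sum_lessThan_middle by (simp add: nth swap move[of c] move[of d] zero nth_append)
  ultimately have "?p = - (?r - ?q - ?s)"
    using Pf_exchange[where \<mu> = \<mu> and \<beta> = \<beta> and as = ?as and cs = ?cs, OF skew] by simp
  moreover have "p + r = q + s" if "p = - (r - q - s)" for p q r s :: 'a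
    using that by simp
  ultimately show ?thesis by blast
qed

text \<open>The counterpart for odd \<open>length B\<close>. Here the first list is \<open>B\<close>
  alone, so one side of \<open>Pf_exchange\<close> vanishes and all four products come from the
  other.\<close>

lemma Pf_plucker_odd:
  fixes \<mu> :: "nat \<Rightarrow> nat \<Rightarrow> 'a::{idom, ring_char_0}"
  assumes skew: "\<And>i j. \<mu> i j = - \<mu> j i"
  shows "Pf \<mu> \<beta> (a # B) * Pf \<mu> \<beta> (b # B @ [c, d]) + Pf \<mu> \<beta> (B @ [c]) * Pf \<mu> \<beta> (a # b # B @ [d]) =
    Pf \<mu> \<beta> (b # B) * Pf \<mu> \<beta> (a # B @ [c, d]) + Pf \<mu> \<beta> (a # b # B @ [c]) * Pf \<mu> \<beta> (B @ [d])"
    (is "?p + ?r = ?q + ?s")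
proof -
  let ?cs = "a # b # B @ [c, d]"
  note zero = Pf_eq_0[where \<mu> = \<mu>, OF skew]
  have move: "Pf \<mu> \<beta> (x # B) = (-1) ^ length B * Pf \<mu> \<beta> (B @ [x])" for x
    using Pf_move[where \<mu> = \<mu> and us = B and vs = "[]", OF skew] by simp
  have nth: "remove_nth (length B) (B @ [c, d]) = B @ [d]"
    "remove_nth (Suc (length B)) (B @ [c, d]) = B @ [c]"
    using remove_nth_append2[of B 0 "[c, d]"] remove_nth_append2[of B 1 "[c, d]"] by simp_all
  have "(\<Sum>i<length B. (-1) ^ i * Pf \<mu> \<beta> (remove_nth i B) * Pf \<mu> \<beta> (B ! i # ?cs)) = 0"
    by (simp add: zero)
  moreover have "(\<Sum>j<Suc (Suc (Suc (Suc (length B)))). (-1) ^ j * Pf \<mu> \<beta> (?cs ! j # B) * Pf \<mu> \<beta> (remove_nth j ?cs)) =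
    ?p - ?q + ?r - ?s"
    unfolding sum.lessThan_Suc_shift[of _ "Suc (Suc (Suc (length B)))"]
    unfolding sum_lessThan_middle by (simp add: nth move[of c] move[of d] zero nth_append)
  ultimately have "?p - ?q + ?r - ?s = 0"
    using Pf_exchange[where \<mu> = \<mu> and \<beta> = \<beta> and as = B and cs = ?cs, OF skew] by simp
  moreover have "p + r = q + s" if "p - q + r - s = 0" for p q r s :: 'a
    using that by (simp add: algebra_simps)
  ultimately show ?thesis by blast
qed

section \<open>Tau functions and numerators as Pfaffians over the polynomial ring\<close>

lemma pf_entry_const_poly:
  "pf_entry (\<lambda>i j. [:\<mu> i j:]) (\<lambda>i. [:\<beta> i:]) (map_label (\<lambda>x. [:x:]) a) (map_label (\<lambda>x. [:x:]) b) =
    [:pf_entry \<mu> \<beta> a b:]"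
  by (cases a; cases b) (auto simp: poly_const_pow)

text \<open>Embedding constants is a ring homomorphism and commutes with the expansion along the
  first label. This lets \<open>tau\<close> enter Pfaffian identities between polynomials.\<close>

lemma Pf_poly_const:
  "Pf_poly \<mu> \<beta> (map (map_label (\<lambda>x. [:x:])) as) = [:Pf \<mu> \<beta> as:]"
proof (induction "length as" arbitrary: as rule: less_induct)
  case less
  show ?case
  proof (cases as)
    case Nil
    then show ?thesis by (simp add: Pf_poly_def Pf_Nil)
  next
    case (Cons b bs)
    let ?h = "map_label (\<lambda>x. [:x:])"
    have IH: "Pf_poly \<mu> \<beta> (remove_nth k (map ?h bs)) = [:Pf \<mu> \<beta> (remove_nth k bs):]"
      if "k < length bs" for k
    proof -
      have "remove_nth k (map ?h bs) = map ?h (remove_nth k bs)"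
        by (simp add: remove_nth_def take_map drop_map)
      then show ?thesis
        using less[of "remove_nth k bs"] that Cons by (simp add: length_remove_nth)
    qed
    have "Pf_poly \<mu> \<beta> (map ?h as) =
      (\<Sum>k<length bs. (-1) ^ k * [:pf_entry \<mu> \<beta> b (bs ! k):] * Pf_poly \<mu> \<beta> (remove_nth k (map ?h bs)))"
      unfolding Cons list.map Pf_poly_def Pf_Cons by (simp add: pf_entry_const_poly)
    also have "\<dots> = (\<Sum>k<length bs. [:(-1) ^ k * pf_entry \<mu> \<beta> b (bs ! k) * Pf \<mu> \<beta> (remove_nth k bs):])"
    proof (intro sum.cong refl)
      fix k assume "k \<in> {..<length bs}"
      then show "(-1) ^ k * [:pf_entry \<mu> \<beta> b (bs ! k):] * Pf_poly \<mu> \<beta> (remove_nth k (map ?h bs)) =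
        [:(-1) ^ k * pf_entry \<mu> \<beta> b (bs ! k) * Pf \<mu> \<beta> (remove_nth k bs):]"
        by (cases "even k") (simp_all add: IH)
    qed
    also have "\<dots> = [:Pf \<mu> \<beta> as:]"
      unfolding Cons Pf_Cons by (rule sum_to_poly)
    finally show ?thesis .
  qed
qed

lemma tau_poly:
  "[:tau \<mu> \<beta> m (int k):] =
    Pf_poly \<mu> \<beta> ((if even k then [] else [D]) @ map Idx [m..<m + k])"
proof -
  have "map_label (\<lambda>x::real. [:x:]) \<circ> Idx = Idx" by auto
  then show ?thesis
    using Pf_poly_const[of \<mu> \<beta> "map Idx [m..<m + k]"] Pf_poly_const[of \<mu> \<beta> "D # map Idx [m..<m + k]"]
    by (simp add: tau_def)
qed

text \<open>The Pfaffian in \<open>Q\<close> before any division, so that the Pluecker relations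
  apply to it directly.\<close>

definition Q_numerator :: "(nat \<Rightarrow> nat \<Rightarrow> real) \<Rightarrow> (nat \<Rightarrow> real) \<Rightarrow> nat \<Rightarrow> int \<Rightarrow> real poly" where
  "Q_numerator \<mu> \<beta> m k =
     (if k < 0 then 0
      else Pf_poly \<mu> \<beta> ((if even k then [] else [D]) @ map Idx [m..<m + nat k + 1] @ [Z [:0, 1:]]))"

lemma Q_numerator_nat:
  "Q_numerator \<mu> \<beta> m (int k) =
    Pf_poly \<mu> \<beta> ((if even k then [] else [D]) @ map Idx [m..<m + (k + 1)] @ [Z [:0, 1:]])"
  by (simp add: Q_numerator_def)

lemma monom_mult_Q:
  "[:0, 1:] ^ m * Q \<mu> \<beta> m k = smult (1 / tau \<mu> \<beta> m k) (Q_numerator \<mu> \<beta> m k)"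
proof -
  let ?P = "Pf_poly \<mu> \<beta>" and ?z = "Z [:0, 1:]"
  have "[:0, 1:] ^ m * (Pf_poly \<mu> \<beta> (as @ [Z [:0, 1:]]) div [:0, 1:] ^ m) = Pf_poly \<mu> \<beta> (as @ [Z [:0, 1:]])"
    if "\<And>i. Idx i \<in> set as \<Longrightarrow> m \<le> i" for as
    by (rule dvd_mult_div_cancel[OF monom_dvd_Pf_poly[OF that]])
  note cancel = this
  have "[:0, 1:] ^ m * (?P (map Idx [m..<m + nat k + 1] @ [?z]) div [:0, 1:] ^ m) =
      ?P (map Idx [m..<m + nat k + 1] @ [?z])"
    by (rule cancel) auto
  moreover have "[:0, 1:] ^ m * (?P ((D # map Idx [m..<m + nat k + 1]) @ [?z]) div [:0, 1:] ^ m) =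
      ?P ((D # map Idx [m..<m + nat k + 1]) @ [?z])"
    by (rule cancel) auto
  ultimately show ?thesis by (simp add: Q_def Q_numerator_def)
qed

text \<open>This is the claim multiplied by \<open>z ^ m\<close> and the common denominator of its
  coefficients. The factor \<open>z\<close> on the right is absorbed, as numerators of level
  \<open>m + 1\<close> belong to \<open>z ^ (m + 1)\<close>.\<close>

lemma Q_numerator_relation:
  assumes skew: "\<And>i j. \<mu> i j = - \<mu> j i"
  shows "smult (tau \<mu> \<beta> (m + 1) (int n)) (Q_numerator \<mu> \<beta> m (int n + 1))
      + smult (tau \<mu> \<beta> (m + 1) (int n + 1)) (Q_numerator \<mu> \<beta> m (int n))
    = smult (tau \<mu> \<beta> m (int n + 1)) (Q_numerator \<mu> \<beta> (m + 1) (int n))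
      + smult (tau \<mu> \<beta> m (int n + 2)) (Q_numerator \<mu> \<beta> (m + 1) (int n - 1))"
proof -
  define B :: "real poly label list" where "B = map Idx [m + 1..<m + 1 + n]"
  define M :: "real poly label" where "M = Idx (m + 1 + n)"
  define z where "z = Z [:0, 1 :: real:]"
  let ?P = "Pf_poly \<mu> \<beta>"
  have skew': "[:\<mu> i j:] = - [:\<mu> j i:]" for i j using skew[of i j] by simp
  \<comment> \<open>Every index range involved is \<open>B\<close>, possibly with
    \<open>Idx m\<close> in front or \<open>M\<close> behind.\<close>
  have idx: "map Idx [m + 1..<m + 1 + (n + 1)] = B @ [M]" "map Idx [m..<m + (n + 1)] = Idx m # B"
    "map Idx [m..<m + (n + 2)] = Idx m # B @ [M]" "map Idx [m..<m + (n + 1 + 1)] = Idx m # B @ [M]"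
    by (simp_all add: B_def M_def upt_conv_Cons)
  have taus: "[:tau \<mu> \<beta> (m + 1) (int n):] = ?P ((if even n then [] else [D]) @ B)"
    "[:tau \<mu> \<beta> (m + 1) (int n + 1):] = ?P ((if even n then [D] else []) @ B @ [M])"
    "[:tau \<mu> \<beta> m (int n + 1):] = ?P ((if even n then [D] else []) @ Idx m # B)"
    "[:tau \<mu> \<beta> m (int n + 2):] = ?P ((if even n then [] else [D]) @ Idx m # B @ [M])"
    using tau_poly[of \<mu> \<beta> "m + 1" n] tau_poly[of \<mu> \<beta> "m + 1" "n + 1"]
      tau_poly[of \<mu> \<beta> m "n + 1"] tau_poly[of \<mu> \<beta> m "n + 2"]
    unfolding idx B_def[symmetric] by (simp_all add: add.commute)
  have nums: "Q_numerator \<mu> \<beta> m (int n + 1) = ?P ((if even n then [D] else []) @ Idx m # B @ [M, z])"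
    "Q_numerator \<mu> \<beta> m (int n) = ?P ((if even n then [] else [D]) @ Idx m # B @ [z])"
    "Q_numerator \<mu> \<beta> (m + 1) (int n) = ?P ((if even n then [] else [D]) @ B @ [M, z])"
    using Q_numerator_nat[of \<mu> \<beta> m "n + 1"] Q_numerator_nat[of \<mu> \<beta> m n] Q_numerator_nat[of \<mu> \<beta> "m + 1" n]
    unfolding idx z_def[symmetric] by (simp_all add: add.commute)
  have num: "Q_numerator \<mu> \<beta> (m + 1) (int n - 1) = ?P ((if even n then [D] else []) @ B @ [z])"
  proof (cases n)
    case 0
    \<comment> \<open>The convention \<open>Q\<^sub>-\<^sub>1 = 0\<close> agrees with \<open>Pf(d, z) = 0\<close>.\<close>
    then show ?thesis
      by (simp add: Q_numerator_def B_def z_def Pf_poly_def Pf_Cons)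
  next
    case (Suc n')
    then show ?thesis by (simp add: Q_numerator_def B_def z_def)
  qed
  have smult: "smult c p = [:c:] * p" for c and p :: "real poly" by simp
  show ?thesis
  \<comment> \<open>The parity of \<open>n = length B\<close> decides which factor of each product
    carries \<open>D\<close>, and so which Pluecker relation applies.\<close>
  proof (cases "even n")
    case True
    have "?P B * ?P (D # Idx m # B @ [M, z]) + ?P (D # B @ [M]) * ?P (Idx m # B @ [z]) =
      ?P (D # Idx m # B) * ?P (B @ [M, z]) + ?P (Idx m # B @ [M]) * ?P (D # B @ [z])"
      unfolding Pf_poly_def by (rule Pf_plucker_even[OF skew'])
    then show ?thesis unfolding smult taus nums num using True by simp
  next
    case False
    have "?P (D # B) * ?P (Idx m # B @ [M, z]) + ?P (B @ [M]) * ?P (D # Idx m # B @ [z]) =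
      ?P (Idx m # B) * ?P (D # B @ [M, z]) + ?P (D # Idx m # B @ [M]) * ?P (B @ [z])"
      unfolding Pf_poly_def by (rule Pf_plucker_odd[OF skew'])
    then show ?thesis unfolding smult taus nums num using False by simp
  qed
qed

section \<open>The relation between adjacent families\<close>

theorem theorem2p4:
  fixes \<mu> :: "nat \<Rightarrow> nat \<Rightarrow> real" and \<beta> :: "nat \<Rightarrow> real" and n m :: nat
  assumes skew: "\<And>i j. \<mu> i j = - \<mu> j i"
    and tau_nonzero: "\<And>k l :: nat. tau \<mu> \<beta> l (int k) \<noteq> 0"
  shows
    "Q \<mu> \<beta> m (int n + 1)
       + smult (tau \<mu> \<beta> m (int n) * tau \<mu> \<beta> (m + 1) (int n + 1)
                / (tau \<mu> \<beta> m (int n + 1) * tau \<mu> \<beta> (m + 1) (int n)))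
           (Q \<mu> \<beta> m (int n))
     = [:0, 1:] *
         (Q \<mu> \<beta> (m + 1) (int n)
          + smult (tau \<mu> \<beta> m (int n + 2) * tau \<mu> \<beta> (m + 1) (int n - 1)
                   / (tau \<mu> \<beta> m (int n + 1) * tau \<mu> \<beta> (m + 1) (int n)))
              (Q \<mu> \<beta> (m + 1) (int n - 1)))"
    (is "?L = _ * ?R")
proof -
  let ?X = "[:0, 1 :: real:]"
  let ?N = "Q_numerator \<mu> \<beta>"
  let ?c = "1 / (tau \<mu> \<beta> m (int n + 1) * tau \<mu> \<beta> (m + 1) (int n))"
  have nz: "tau \<mu> \<beta> m (int n) \<noteq> 0" "tau \<mu> \<beta> (m + 1) (int n) \<noteq> 0" "tau \<mu> \<beta> m (int n + 1) \<noteq> 0"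
    using tau_nonzero[of m n] tau_nonzero[of "m + 1" n] tau_nonzero[of m "n + 1"]
    by (simp_all add: add.commute)
  \<comment> \<open>For \<open>n = 0\<close> this \<open>tau\<close> is \<open>0\<close> and cannot
    be cancelled, but then the numerator is \<open>0\<close> as well.\<close>
  have last: "tau \<mu> \<beta> (m + 1) (int n - 1) \<noteq> 0 \<or> ?N (m + 1) (int n - 1) = 0"
  proof (cases n)
    case 0
    then show ?thesis by (simp add: Q_numerator_def)
  next
    case (Suc n')
    then show ?thesis using tau_nonzero[of "m + 1" n'] by simp
  qed
  \<comment> \<open>The factor \<open>tau \<mu> \<beta> m (int n)\<close> of the coefficient cancels
    the denominator of \<open>Q \<mu> \<beta> m (int n)\<close>, so \<open>?c\<close> can be pulled
    out.\<close>
  have "?X ^ m * ?L = smult ?c (smult (tau \<mu> \<beta> (m + 1) (int n)) (?N m (int n + 1))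
      + smult (tau \<mu> \<beta> (m + 1) (int n + 1)) (?N m (int n)))"
    using nz by (simp add: distrib_left monom_mult_Q smult_add_right)
  also have "\<dots> = smult ?c (smult (tau \<mu> \<beta> m (int n + 1)) (?N (m + 1) (int n))
      + smult (tau \<mu> \<beta> m (int n + 2)) (?N (m + 1) (int n - 1)))"
    by (simp only: Q_numerator_relation[OF skew])
  also have "\<dots> = ?X ^ (m + 1) * ?R"
    unfolding distrib_left mult_smult_right monom_mult_Q using nz last
    by (auto simp add: smult_add_right)
  finally have "?X ^ m * ?L = ?X ^ m * (?X * ?R)" by (simp only: power_Suc2 Suc_eq_plus1[symmetric] mult.assoc)
  then show ?thesis by (subst (asm) mult_left_cancel) auto
qed

end
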